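(* Let $L_1,L_2\ge 1$ and $S_1,S_2\ge 0$ be integers with $L_i+S_i\ge 2$ for $i=1,2$, and assume $\gcd(L_1,S_1,L_2,S_2)>1$. Then the two-dimensional sequence $\big(\xi_{L_1,S_1}^n,\xi_{L_2,S_2}^n\big)_{n\ge 0}$ is not dense in $[0,1]^2$.
   Context: LS-sequence of points. Let $L\ge 1$, $S\ge 0$ be integers with $L+S\ge 2$, and let $\beta\in(0,1)$ be the unique positive solution of $L\beta+S\beta^2=1$. Define $t_0=1$, $t_1=L+S$, $l_0=1$, $l_1=L$ and $t_n=Lt_{n-1}+St_{n-2}$, $l_n=Ll_{n-1}+Sl_{n-2}$ for $n\ge 2$. The LS-sequence $(\xi_{L,S}^N)_{N\ge 0}$ in $[0,1)$ is defined by $\xi_{L,S}^0=0$ and, for $n\ge 0$ and $t_n\le N<t_{n+1}$, writing uniquely $N=t_n+\eta l_n+r$ with $0\le\eta\le L+S-2$, $0\le r<l_n$: $$\xi_{L,S}^N=\xi_{L,S}^r+\beta^{n+1}\min\{L,\eta+1\}+\beta^{n+2}\max\{\eta+1-L,0\}.$$ (For $S=0$ this is the van der Corput sequence in base $L$.) *)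

theory Defs
  imports "HOL-Analysis.Analysis"
begin

definition ls_beta :: "nat \<Rightarrow> nat \<Rightarrow> real" where
  "ls_beta L S = (THE b. 0 < b \<and> real L * b + real S * b\<^sup>2 = 1)"

fun ls_t :: "nat \<Rightarrow> nat \<Rightarrow> nat \<Rightarrow> nat" where
  "ls_t L S 0 = 1"
| "ls_t L S (Suc 0) = L + S"
| "ls_t L S (Suc (Suc n)) = L * ls_t L S (Suc n) + S * ls_t L S n"

fun ls_l :: "nat \<Rightarrow> nat \<Rightarrow> nat \<Rightarrow> nat" where
  "ls_l L S 0 = 1"
| "ls_l L S (Suc 0) = L"
| "ls_l L S (Suc (Suc n)) = L * ls_l L S (Suc n) + S * ls_l L S n"

definition ls_level :: "nat \<Rightarrow> nat \<Rightarrow> nat \<Rightarrow> nat" where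
  "ls_level L S N = (THE n. ls_t L S n \<le> N \<and> N < ls_t L S (Suc n))"

lemma ls_t_pos: "L \<ge> 1 \<Longrightarrow> ls_t L S n > 0"
  by (induction L S n rule: ls_t.induct) auto

lemma ls_l_pos: "L \<ge> 1 \<Longrightarrow> ls_l L S n > 0"
  by (induction L S n rule: ls_l.induct) auto

text \<open>
  The decomposition \<open>N = t\<^sub>n + \<eta> l\<^sub>n + r\<close> with \<open>0 \<le> r < l\<^sub>n\<close> is division of \<open>N - t\<^sub>n\<close> by \<open>l\<^sub>n\<close>; the
  bound \<open>\<eta> \<le> L + S - 2\<close> is then automatic, see \<open>ls_decomp_ex1\<close>. The guard \<open>L = 0\<close> only serves
  termination. The term \<open>max {\<eta> + 1 - L, 0}\<close> is truncated subtraction on natural numbers. That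
  the recursion of the LS-sequence holds as usually stated is \<open>ls_seq_rec\<close> below.
\<close>

function ls_seq :: "nat \<Rightarrow> nat \<Rightarrow> nat \<Rightarrow> real" where
  "ls_seq L S N =
    (if L = 0 \<or> N = 0 then 0
     else let n = ls_level L S N;
              \<eta> = (N - ls_t L S n) div ls_l L S n;
              r = (N - ls_t L S n) mod ls_l L S n
          in ls_seq L S r + ls_beta L S ^ (n + 1) * real (min L (\<eta> + 1))
                          + ls_beta L S ^ (n + 2) * real (\<eta> + 1 - L))"
  by auto
termination
proof (relation "Wellfounded.measure (\<lambda>(L, S, N). N)")
  fix L S N n \<eta> r :: nat
  assume "\<not> (L = 0 \<or> N = 0)" and r: "r = (N - ls_t L S n) mod ls_l L S n"
  then have "N - ls_t L S n < N"
    using ls_t_pos[of L S n] by simp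
  moreover have "r \<le> N - ls_t L S n"
    unfolding r by (rule mod_less_eq_dividend)
  ultimately show "((L, S, r), (L, S, N)) \<in> Wellfounded.measure (\<lambda>(L, S, N). N)"
    by simp
qed simp

declare ls_seq.simps [simp del]

lemma ls_beta_ex1:
  assumes "L \<ge> 1" "L + S \<ge> 2"
  shows "\<exists>!b. 0 < b \<and> real L * b + real S * b\<^sup>2 = 1"
proof -
  let ?f = "\<lambda>b::real. real L * b + real S * b\<^sup>2"
  have mono: "?f x < ?f y" if "0 < x" "x < y" for x y
  proof -
    have "real L * x < real L * y" using assms that by simp
    moreover have "real S * x\<^sup>2 \<le> real S * y\<^sup>2"
      using that by (intro mult_left_mono power_mono) auto
    ultimately show ?thesis by linarith
  qed
  have "1 \<le> ?f 1" using assms by simp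
  moreover have "continuous_on {0..1} ?f" by (intro continuous_intros)
  ultimately obtain b where b: "0 \<le> b" "b \<le> 1" "?f b = 1"
    using IVT'[of ?f 0 1 1] by auto
  then have "b \<noteq> 0" by auto
  show ?thesis
  proof (rule ex1I[of _ b])
    show "0 < b \<and> ?f b = 1" using b \<open>b \<noteq> 0\<close> by simp
    fix c assume c: "0 < c \<and> ?f c = 1"
    show "c = b"
      using mono[of c b] mono[of b c] b c \<open>b \<noteq> 0\<close> by (cases c b rule: linorder_cases) auto
  qed
qed

lemma ls_beta:
  assumes "L \<ge> 1" "L + S \<ge> 2"
  shows "0 < ls_beta L S" "ls_beta L S < 1"
    "real L * ls_beta L S + real S * (ls_beta L S)\<^sup>2 = 1"
proof -
  let ?b = "ls_beta L S"
  have *: "0 < ?b \<and> real L * ?b + real S * ?b\<^sup>2 = 1"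
    unfolding ls_beta_def by (rule theI'[OF ls_beta_ex1[OF assms]])
  then show "0 < ?b" "real L * ?b + real S * ?b\<^sup>2 = 1" by auto
  show "?b < 1"
  proof (rule ccontr)
    assume "\<not> ?b < 1"
    then have 1: "1 \<le> ?b" by simp
    then have "1 \<le> ?b\<^sup>2" by simp
    with 1 have "real L \<le> real L * ?b" "real S \<le> real S * ?b\<^sup>2"
      using mult_left_mono[of 1 ?b "real L"] mult_left_mono[of 1 "?b\<^sup>2" "real S"] by auto
    moreover have "real L + real S \<ge> 2" using assms(2) by linarith
    ultimately show False using * by linarith
  qed
qed

lemma ls_t_Suc:
  assumes "L \<ge> 1"
  shows "ls_t L S (Suc n) = ls_t L S n + (L + S - 1) * ls_l L S n"
proof (induction n rule: less_induct)
  case (less n)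
  consider "n = 0" | "n = 1" | m where "n = Suc (Suc m)"
    by (metis One_nat_def not0_implies_Suc)
  then show ?case
  proof cases
    case 1
    then show ?thesis using assms by simp
  next
    case 2
    obtain k where "L = Suc k" using assms by (cases L) auto
    with 2 show ?thesis by (simp add: algebra_simps)
  next
    case 3
    have "ls_t L S (Suc n) = L * ls_t L S n + S * ls_t L S (Suc m)"
      using 3 by simp
    also have "\<dots> = L * (ls_t L S (Suc m) + (L + S - 1) * ls_l L S (Suc m))
                    + S * (ls_t L S m + (L + S - 1) * ls_l L S m)"
      using less[of m] less[of "Suc m"] 3 by simp
    also have "\<dots> = ls_t L S n + (L + S - 1) * ls_l L S n"
      using 3 by (simp add: algebra_simps)
    finally show ?thesis .
  qed
qed

lemma ls_t_strict_mono:
  assumes "L \<ge> 1" "L + S \<ge> 2"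
  shows "strict_mono (ls_t L S)"
  using ls_t_Suc[OF assms(1), of S] ls_l_pos[OF assms(1), of S] assms(2)
  by (intro strict_mono_Suc_iff[THEN iffD2]) auto

lemma ls_level_ex1:
  assumes "L \<ge> 1" "L + S \<ge> 2" "N \<ge> 1"
  shows "\<exists>!n. ls_t L S n \<le> N \<and> N < ls_t L S (Suc n)"
proof -
  note sm = ls_t_strict_mono[OF assms(1,2)]
  have "N < ls_t L S (Suc N)"
    using strict_mono_imp_increasing[OF sm, of "Suc N"] by simp
  then have ex: "\<exists>n. N < ls_t L S (Suc n)" by blast
  define n where "n = (LEAST n. N < ls_t L S (Suc n))"
  have n: "N < ls_t L S (Suc n)" unfolding n_def by (rule LeastI_ex[OF ex])
  have "ls_t L S n \<le> N"
  proof (cases n)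
    case (Suc m)
    then show ?thesis
      using not_less_Least[of m "\<lambda>n. N < ls_t L S (Suc n)"] n_def by simp
  qed (use assms in simp)
  moreover have "m \<le> k" if "ls_t L S m \<le> N" "N < ls_t L S (Suc k)" for m k
    using strict_mono_less[OF sm, of m "Suc k"] that by simp
  ultimately show ?thesis
    using n by (intro ex1I[of _ n]) (auto intro: order_antisym)
qed

lemma ls_level_eq:
  assumes "L \<ge> 1" "L + S \<ge> 2" "ls_t L S n \<le> N" "N < ls_t L S (Suc n)"
  shows "ls_level L S N = n"
proof -
  have "N \<ge> 1" using assms(3) ls_t_pos[OF assms(1), of S n] by linarith
  then show ?thesis
    unfolding ls_level_def using ls_level_ex1[OF assms(1,2)] assms(3,4)
    by (intro the1_equality) auto
qed

lemma ls_decomp_ex1: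
  assumes "L \<ge> 1" "L + S \<ge> 2" "ls_t L S n \<le> N" "N < ls_t L S (Suc n)"
  shows "\<exists>!(\<eta>, r). \<eta> \<le> L + S - 2 \<and> r < ls_l L S n \<and> N = ls_t L S n + \<eta> * ls_l L S n + r"
proof -
  let ?l = "ls_l L S n" and ?d = "N - ls_t L S n"
  have l: "?l > 0" by (rule ls_l_pos[OF assms(1)])
  have "?d < (L + S - 1) * ?l"
    using assms ls_t_Suc[OF assms(1), of S n] by linarith
  then have "?d div ?l < L + S - 1" using l by (simp add: less_mult_imp_div_less)
  then have 1: "?d div ?l \<le> L + S - 2" by linarith
  show ?thesis
  proof (rule ex1I[of _ "(?d div ?l, ?d mod ?l)"])
    show "case (?d div ?l, ?d mod ?l) of (\<eta>, r) \<Rightarrow>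
        \<eta> \<le> L + S - 2 \<and> r < ?l \<and> N = ls_t L S n + \<eta> * ?l + r"
      using 1 l assms(3) by simp
  next
    fix p :: "nat \<times> nat"
    assume "case p of (\<eta>, r) \<Rightarrow> \<eta> \<le> L + S - 2 \<and> r < ?l \<and> N = ls_t L S n + \<eta> * ?l + r"
    then show "p = (?d div ?l, ?d mod ?l)"
      by (cases p) auto
  qed
qed

lemma ls_seq_0 [simp]: "ls_seq L S 0 = 0"
  by (simp add: ls_seq.simps)

theorem ls_seq_rec:
  assumes "L \<ge> 1" "L + S \<ge> 2" "\<eta> \<le> L + S - 2" "r < ls_l L S n"
  shows "ls_seq L S (ls_t L S n + \<eta> * ls_l L S n + r) =
    ls_seq L S r + ls_beta L S ^ (n + 1) * min (real L) (real \<eta> + 1)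
                 + ls_beta L S ^ (n + 2) * max (real \<eta> + 1 - real L) 0"
proof -
  let ?l = "ls_l L S n"
  let ?N = "ls_t L S n + \<eta> * ?l + r"
  have "\<eta> * ?l + r < Suc \<eta> * ?l" using assms(4) by simp
  also have "\<dots> \<le> (L + S - 1) * ?l"
    using assms(2,3) by (intro mult_right_mono) auto
  finally have "?N < ls_t L S (Suc n)"
    using ls_t_Suc[OF assms(1), of S n] by simp
  then have lev: "ls_level L S ?N = n"
    by (intro ls_level_eq assms) auto
  have pos: "?N > 0" using ls_t_pos[OF assms(1), of S n] by simp
  have d: "?N - ls_t L S n = \<eta> * ?l + r" by simp
  have q: "(\<eta> * ?l + r) div ?l = \<eta>" "(\<eta> * ?l + r) mod ?l = r"
    using assms(4) by auto
  have "ls_seq L S ?N = ls_seq L S r + ls_beta L S ^ (n + 1) * real (min L (\<eta> + 1))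
      + ls_beta L S ^ (n + 2) * real (\<eta> + 1 - L)"
  proof -
    have "\<not> (L = 0 \<or> ?N = 0)" using assms(1) pos by linarith
    then show ?thesis
      using ls_seq.simps[of L S ?N] by (simp only: lev Let_def d q if_False)
  qed
  moreover have "real (min L (\<eta> + 1)) = min (real L) (real \<eta> + 1)"
    by auto
  moreover have "real (\<eta> + 1 - L) = max (real \<eta> + 1 - real L) 0"
    by linarith
  ultimately show ?thesis by simp
qed

end

theory Submission
  imports Defs "HOL-Number_Theory.Cong"
begin

text \<open>
  If \<open>d\<close> divides \<open>L\<close> and \<open>S\<close>, then it divides \<open>t\<^sub>n\<close> and \<open>l\<^sub>n\<close> for all \<open>n \<ge> 1\<close>, so that the residue
  of \<open>N\<close> modulo \<open>d\<close> is that of its level-zero part. For \<open>k < L\<close> the points of the sequence in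
  \<open>[k\<beta>, (k+1)\<beta>)\<close> are those with level-zero part \<open>k\<close>, hence they all have index \<open>N \<equiv> k (mod d)\<close>.
  When \<open>d > 1\<close> divides all four parameters, no index can be \<open>0\<close> and \<open>1\<close> modulo \<open>d\<close> at once, and
  the pair of sequences misses the rectangle \<open>(0, \<beta>\<^sub>1) \<times> (\<beta>\<^sub>2, 2\<beta>\<^sub>2)\<close>.
\<close>

lemma dvd_ls_t:
  assumes "d dvd L" "d dvd S" "n \<ge> 1"
  shows "d dvd ls_t L S n"
  using assms by (cases "(L, S, n)" rule: ls_t.cases) auto

lemma dvd_ls_l:
  assumes "d dvd L" "d dvd S" "n \<ge> 1"
  shows "d dvd ls_l L S n"
  using assms by (cases "(L, S, n)" rule: ls_l.cases) auto

text \<open>This places the bound for long intervals among the blocks of the decomposition: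
  \<open>N = t + \<eta> * l + r\<close> at level \<open>n\<close> is long at the next stage exactly
  when \<open>\<eta> + 1 < L\<close>.\<close>

lemma ls_l_Suc:
  assumes "L \<ge> 1"
  shows "ls_l L S (Suc n) = ls_t L S n + (L - 1) * ls_l L S n"
proof (induction n rule: less_induct)
  case (less n)
  obtain k where L: "L = Suc k" using assms by (cases L) auto
  consider "n = 0" | "n = 1" | m where "n = Suc (Suc m)"
    by (metis One_nat_def not0_implies_Suc)
  then show ?case
  proof cases
    case 3
    have "ls_l L S (Suc n) = L * ls_l L S n + S * ls_l L S (Suc m)"
      using 3 by simp
    also have "\<dots> = L * (ls_t L S (Suc m) + (L - 1) * ls_l L S (Suc m))
                    + S * (ls_t L S m + (L - 1) * ls_l L S m)"
      using less[of m] less[of "Suc m"] 3 by simp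
    also have "\<dots> = ls_t L S n + (L - 1) * ls_l L S n"
      using 3 by (simp add: L algebra_simps)
    finally show ?thesis .
  qed (auto simp: L algebra_simps)
qed

lemma ls_l_le_ls_t:
  assumes "L \<ge> 1"
  shows "ls_l L S n \<le> ls_t L S n"
  using assms by (cases n) (auto simp: ls_l_Suc ls_t_Suc simp del: ls_l.simps(3) ls_t.simps(3))

text \<open>
  The points with index below \<open>t\<^sub>n\<close> are the left endpoints of the \<open>n\<close>-th LS-partition of \<open>[0,1)\<close>;
  those with index below \<open>l\<^sub>n\<close> belong to its long intervals, of length \<open>\<beta>\<^sup>n\<close>, and the others to its
  short ones, of length \<open>\<beta>\<^bsup>n+1\<^esup>\<close>. Keeping track of the whole interval makes the induction work.
\<close>

lemma ls_partition_interval_residue: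
  assumes L: "L \<ge> 1" and LS: "L + S \<ge> 2" and d: "d dvd L" "d dvd S"
    and N: "N < ls_t L S (Suc n)"
  defines "\<beta> \<equiv> ls_beta L S"
  shows "real L * \<beta> \<le> ls_seq L S N \<or>
    (\<exists>k<L. [N = k] (mod d) \<and> real k * \<beta> \<le> ls_seq L S N \<and>
      ls_seq L S N + (if N < ls_l L S (Suc n) then \<beta> ^ Suc n else \<beta> ^ Suc (Suc n))
        \<le> (real k + 1) * \<beta>)"
  using N
proof (induction n arbitrary: N)
  note b = ls_beta[OF L LS, folded \<beta>_def]
  note rec = ls_seq_rec[OF L LS, folded \<beta>_def]
  {
    case 0
    show ?case
    proof (cases N)
      case 0
      then show ?thesis using L b(1) by (intro disjI2 exI[of _ 0]) auto
    next
      case (Suc \<eta>)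
      then have "\<eta> \<le> L + S - 2" using 0 by simp
      then have val: "ls_seq L S N
          = \<beta> * min (real L) (real \<eta> + 1) + \<beta>\<^sup>2 * max (real \<eta> + 1 - real L) 0"
        \<comment> \<open>At level 0 both counts are 1, so \<open>N = 1 + \<eta>\<close> and the
          remainder is 0.\<close>
        using rec[of \<eta> 0 0] Suc by (simp add: power2_eq_square)
      show ?thesis
      proof (cases "N < L")
        case True
        then have "ls_seq L S N = real N * \<beta>" using val Suc by simp
        then show ?thesis using True by (intro disjI2 exI[of _ N]) (simp add: algebra_simps)
      next
        case False
        then have "ls_seq L S N = \<beta> * real L + \<beta>\<^sup>2 * (real \<eta> + 1 - real L)"
          using val Suc by (simp add: min_def max_def)
        moreover have "0 \<le> \<beta>\<^sup>2 * (real \<eta> + 1 - real L)"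
          using False Suc by (intro mult_nonneg_nonneg) auto
        ultimately show ?thesis by (simp add: mult.commute)
      qed
    qed
  next
    case (Suc n)
    define m where "m = Suc n"
    have pw: "\<beta> ^ Suc m \<le> \<beta> ^ m" "\<beta> ^ Suc (Suc m) \<le> \<beta> ^ Suc m" "0 < \<beta> ^ m"
        "0 < \<beta> ^ Suc m" "0 < \<beta> ^ Suc (Suc m)"
      using b by (auto intro!: power_decreasing simp del: power_Suc)
    \<comment> \<open>A long interval splits into \<open>L\<close> long and \<open>S\<close> short
      pieces of the next stage.\<close>
    have step: "real L * \<beta> ^ Suc m + real S * \<beta> ^ Suc (Suc m) = \<beta> ^ m"
      using arg_cong[OF b(3), of "\<lambda>x. \<beta> ^ m * x"]
      by (simp add: algebra_simps power2_eq_square)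
    show ?case
    proof (cases "N < ls_t L S m")
      case True
      \<comment> \<open>An old left endpoint stays in place, and \<open>\<beta> ^ Suc m\<close> lies
        between its old and new width.\<close>
      have "real L * \<beta> \<le> ls_seq L S N \<or>
        (\<exists>k<L. [N = k] (mod d) \<and> real k * \<beta> \<le> ls_seq L S N \<and>
          ls_seq L S N + \<beta> ^ Suc m \<le> (real k + 1) * \<beta>)"
        using Suc.IH[of N] True pw(1) unfolding m_def
        by (fastforce split: if_splits simp del: power_Suc)
      then show ?thesis using pw(2) unfolding m_def
        by (fastforce simp del: power_Suc)
    next
      case False
      then obtain \<eta> r where \<eta>: "\<eta> \<le> L + S - 2" and r: "r < ls_l L S m"
        and Ndec: "N = ls_t L S m + \<eta> * ls_l L S m + r"
        using ls_decomp_ex1[OF L LS, of m N] Suc.prems unfolding m_def by auto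
      have cong: "[N = r] (mod d)"
      proof -
        have "d dvd ls_t L S m + \<eta> * ls_l L S m"
          using dvd_ls_t[OF d, of m] dvd_ls_l[OF d, of m] by (simp add: m_def)
        then show ?thesis unfolding Ndec by (auto simp: cong_def elim!: dvdE)
      qed
      let ?a = "\<beta> ^ Suc m * min (real L) (real \<eta> + 1)
        + \<beta> ^ Suc (Suc m) * max (real \<eta> + 1 - real L) 0"
      let ?w = "if N < ls_l L S (Suc m) then \<beta> ^ Suc m else \<beta> ^ Suc (Suc m)"
      have val: "ls_seq L S N = ls_seq L S r + ?a"
        using rec[OF \<eta> r] Ndec by simp
      have a0: "0 \<le> ?a"
        using pw by (intro add_nonneg_nonneg mult_nonneg_nonneg) auto
      \<comment> \<open>Piece \<open>\<eta> + 1\<close> of the parent interval, counted from 0,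
        starts at offset \<open>?a\<close> and must end inside the parent. It is long if
        \<open>\<eta> + 1 < L\<close> and short otherwise.\<close>
      have a1: "?a + ?w \<le> \<beta> ^ m"
      proof (cases "\<eta> + 1 < L")
        case True
        then have "?a = \<beta> ^ Suc m * (real \<eta> + 1)" by (simp add: max_def)
        moreover have "?w \<le> \<beta> ^ Suc m" using pw by simp
        moreover have "\<beta> ^ Suc m * (real \<eta> + 2) \<le> \<beta> ^ Suc m * real L"
          using True pw by (intro mult_left_mono) auto
        moreover have "0 \<le> real S * \<beta> ^ Suc (Suc m)"
          using pw by (intro mult_nonneg_nonneg) auto
        ultimately show ?thesis using step by (simp add: algebra_simps)
      next
        case False
        then have "(L - 1) * ls_l L S m \<le> \<eta> * ls_l L S m" by (intro mult_right_mono) auto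
        then have "\<not> N < ls_l L S (Suc m)"
          unfolding ls_l_Suc[OF L] Ndec by linarith
        then have "?w = \<beta> ^ Suc (Suc m)" by (rule if_not_P)
        moreover have "?a = \<beta> ^ Suc m * real L + \<beta> ^ Suc (Suc m) * (real \<eta> + 1 - real L)"
          using False by (simp add: min_def max_def)
        moreover have "\<beta> ^ Suc (Suc m) * (real \<eta> + 2 - real L) \<le> \<beta> ^ Suc (Suc m) * real S"
          using \<eta> LS pw by (intro mult_left_mono) linarith+
        ultimately show ?thesis using step by (simp add: algebra_simps)
      qed
      \<comment> \<open>Since \<open>r < ls_l L S m\<close>, the parent is long, so the induction
        hypothesis leaves room \<open>\<beta> ^ m\<close> after its left endpoint.\<close>
      have "r < ls_t L S m" using r ls_l_le_ls_t[OF L, of S m] by simp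
      then consider "real L * \<beta> \<le> ls_seq L S r"
        | k where "k < L" "[r = k] (mod d)" "real k * \<beta> \<le> ls_seq L S r"
          "ls_seq L S r + \<beta> ^ m \<le> (real k + 1) * \<beta>"
        using Suc.IH[of r] r unfolding m_def by (auto simp del: power_Suc)
      then show ?thesis
      proof cases
        case 1
        then show ?thesis using val a0 by simp
      next
        case 2
        have "real k * \<beta> \<le> ls_seq L S N" "ls_seq L S N + ?w \<le> (real k + 1) * \<beta>"
          using 2 val a0 a1 by linarith+
        moreover have "[N = k] (mod d)" using cong 2(2) by (rule cong_trans)
        ultimately show ?thesis using 2(1) unfolding m_def by blast
      qed
    qed
  }
qed

lemma ls_seq_index_cong:
  assumes "L \<ge> 1" "L + S \<ge> 2" "d dvd L" "d dvd S" "j < L"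
    and "real j * ls_beta L S < ls_seq L S N" "ls_seq L S N < (real j + 1) * ls_beta L S"
  shows "[N = j] (mod d)"
proof -
  let ?b = "ls_beta L S"
  note b = ls_beta(1)[OF assms(1,2)]
  have "N < ls_t L S (Suc N)"
    using strict_mono_imp_increasing[OF ls_t_strict_mono[OF assms(1,2)], of "Suc N"] by simp
  from ls_partition_interval_residue[OF assms(1-4) this]
  \<comment> \<open>Only \<open>w > 0\<close> is kept of the width; it makes the upper bound on the
    point strict, which forces \<open>k = j\<close>.\<close>
  consider "real L * ?b \<le> ls_seq L S N"
    | k w where "[N = k] (mod d)" "real k * ?b \<le> ls_seq L S N"
        "ls_seq L S N + w \<le> (real k + 1) * ?b" "w > 0"
    using zero_less_power[OF b, of "Suc N"] zero_less_power[OF b, of "Suc (Suc N)"] by metis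
  then show ?thesis
  proof cases
    case 1
    then have "real L * ?b < (real j + 1) * ?b" using assms(7) by linarith
    then show ?thesis using b assms(5) by simp
  next
    case 2
    then have "real k * ?b < (real j + 1) * ?b" "real j * ?b < (real k + 1) * ?b"
      using assms(6,7) by linarith+
    then have "real k < real j + 1" "real j < real k + 1"
      using b by simp_all
    then have "k = j" by linarith
    then show ?thesis using 2(1) by simp
  qed
qed

theorem theorem2:
  fixes L1 S1 L2 S2 :: nat
  assumes "L1 \<ge> 1" and "L2 \<ge> 1"
    and "L1 + S1 \<ge> 2" and "L2 + S2 \<ge> 2"
    and "Gcd {L1, S1, L2, S2} > 1"
  shows "\<not> {0..1} \<times> {0..1} \<subseteq> closure (range (\<lambda>n. (ls_seq L1 S1 n, ls_seq L2 S2 n)))"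
proof
  assume dense: "{0..1} \<times> {0..1} \<subseteq> closure (range (\<lambda>n. (ls_seq L1 S1 n, ls_seq L2 S2 n)))"
  define d where "d = Gcd {L1, S1, L2, S2}"
  have d: "d dvd L1" "d dvd S1" "d dvd L2" "d dvd S2" "d > 1"
    using assms(5) unfolding d_def by (simp_all only: Gcd_dvd insert_iff simp_thms)
  have "L2 > 1" using dvd_imp_le[OF d(3)] d(5) assms(2) by simp
  let ?b1 = "ls_beta L1 S1" and ?b2 = "ls_beta L2 S2"
  note b1 = ls_beta[OF assms(1,3)] and b2 = ls_beta[OF assms(2,4)]
  let ?U = "{0<..<?b1} \<times> {?b2<..<2 * ?b2}"
  let ?R = "range (\<lambda>n. (ls_seq L1 S1 n, ls_seq L2 S2 n))"
  \<comment> \<open>This keeps the rectangle inside the unit square; the witness below is its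
    centre.\<close>
  have "2 * ?b2 \<le> real L2 * ?b2" using \<open>L2 > 1\<close> b2(1) by (intro mult_right_mono) auto
  moreover have "0 \<le> real S2 * ?b2\<^sup>2" by simp
  ultimately have "2 * ?b2 \<le> 1" using b2(3) by linarith
  then have "(?b1 / 2, 3 * ?b2 / 2) \<in> ?U \<inter> {0..1} \<times> {0..1}" using b1(1,2) b2(1) by auto
  then have "?U \<inter> closure ?R \<noteq> {}" using dense by blast
  moreover have "open ?U" by (intro open_Times) auto
  ultimately have "?U \<inter> ?R \<noteq> {}" by (simp add: open_Int_closure_eq_empty)
  then obtain n where n: "0 < ls_seq L1 S1 n" "ls_seq L1 S1 n < ?b1"
      "?b2 < ls_seq L2 S2 n" "ls_seq L2 S2 n < 2 * ?b2"
    by auto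
  have "[n = 0] (mod d)"
    using ls_seq_index_cong[OF assms(1,3) d(1,2), of 0 n] assms(1) n by simp
  moreover have "[n = 1] (mod d)"
    using ls_seq_index_cong[OF assms(2,4) d(3,4), of 1 n] \<open>L2 > 1\<close> n by simp
  ultimately show False using d(5) by (simp add: cong_def)
qed

end
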